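(* Let $T$ be a left-invariant $(0,2)$ tensor field on $E(1,1)$. There exist a left-invariant Riemannian metric $g$ and a constant $c>0$ such that $\mathrm{Ric}(g)=cT$ if and only if $T$ is diagonalisable with $T=\mathrm{diag}(T_1,T_2,T_3)$ in a basis $V_1,V_2,V_3$ of the Lie algebra satisfying $[V_i,V_j]=\sum_{k=1}^3\epsilon_{ijk}\lambda_kV_k$ with $\lambda_1=2$, $\lambda_2=-2$, $\lambda_3=0$, and one of the following conditions is satisfied: (i) $T_1=T_2=0$, $T_3<0$; (ii) $T_1+T_2>0$, $T_3<0$, $T_1T_2<0$. In case (i), there are infinitely many pairs $(g,c)$ solving $\mathrm{Ric}(g)=cT$, but the value of $c$ is the same for all solutions. In case (ii), the pair $(g,c)$ is unique.
   Context: $E(1,1)$ (the Minkowski group) denotes the three-dimensional unimodular Lie group whose Lie algebra has a basis with $[V_i,V_j]=\sum_k\epsilon_{ijk}\lambda_kV_k$, $(\lambda_1,\lambda_2,\lambda_3)=(2,-2,0)$, where $\epsilon_{ijk}$ is the Levi-Civita symbol. Left-invariant tensor fields are identified with tensors on the Lie algebra. $\mathrm{Ric}(g)$ is the Ricci curvature $(0,2)$-tensor of $g$. $T=\mathrm{diag}(T_1,T_2,T_3)$ in the basis $V_1,V_2,V_3$ means $T(V_i,V_i)=T_i$ and $T(V_i,V_j)=0$ for $i\neq j$. Uniqueness and the number of solutions $(g,c)$ are always understood up to scaling of $g$ (so "unique" means that any other solution $(\bar g,\bar c)$ has $\bar c=c$ and $\bar g$ a positive multiple of $g$). *)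

theory Defs
  imports "HOL-Analysis.Analysis"
begin

text \<open>
  Left-invariant tensor fields on a Lie group are identified with tensors on its Lie algebra.
  The Lie algebra of E(1,1) is modelled on \<^typ>\<open>real^3\<close>, with the standard basis as the basis
  that gives the structure constants. Indices range over the type \<^typ>\<open>3\<close>, in which
  \<open>3 = 0\<close>, so that its three elements are \<open>1\<close>, \<open>2\<close> and \<open>3\<close>.
\<close>

definition levi_civita_symbol :: "3 \<Rightarrow> 3 \<Rightarrow> 3 \<Rightarrow> real" where
  "levi_civita_symbol i j k =
     (if (i, j, k) \<in> {(1, 2, 3), (2, 3, 1), (3, 1, 2)} then 1
      else if (i, j, k) \<in> {(1, 3, 2), (3, 2, 1), (2, 1, 3)} then - 1
      else 0)"

definition e11_lambda :: "real^3" where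
  "e11_lambda = vector [2, - 2, 0]"

definition e11_bracket :: "real^3 \<Rightarrow> real^3 \<Rightarrow> real^3" where
  "e11_bracket x y =
     (\<Sum>i\<in>UNIV. \<Sum>j\<in>UNIV. \<Sum>k\<in>UNIV.
        (x $ i * y $ j * (levi_civita_symbol i j k * e11_lambda $ k)) *\<^sub>R axis k 1)"

definition e11_basis :: "(3 \<Rightarrow> real^3) \<Rightarrow> bool" where
  "e11_basis V \<longleftrightarrow>
     inj V \<and> independent (range V) \<and> span (range V) = UNIV \<and>
     (\<forall>i j. e11_bracket (V i) (V j) =
            (\<Sum>k\<in>UNIV. (levi_civita_symbol i j k * e11_lambda $ k) *\<^sub>R V k))"

definition diagonal_in ::
  "(3 \<Rightarrow> real^3) \<Rightarrow> (real^3 \<Rightarrow> real^3 \<Rightarrow> real) \<Rightarrow> real \<Rightarrow> real \<Rightarrow> real \<Rightarrow> bool" where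
  "diagonal_in V T T1 T2 T3 \<longleftrightarrow>
     (\<forall>i j. T (V i) (V j) = (if i = j then vector [T1, T2, T3] $ i else 0))"

definition left_invariant_metric :: "(real^'n \<Rightarrow> real^'n \<Rightarrow> real) \<Rightarrow> bool" where
  "left_invariant_metric g \<longleftrightarrow> bilinear g \<and> (\<forall>x y. g x y = g y x) \<and> (\<forall>x. x \<noteq> 0 \<longrightarrow> g x x > 0)"

text \<open>
  For left-invariant fields the function \<open>g y z\<close> is constant, so that metric compatibility
  \<open>x (g y z) = g (\<nabla> x y) z + g y (\<nabla> x z)\<close> has left-hand side \<open>0\<close>. Existence and uniqueness
  of the connection are \<open>is_levi_civita_connection\<close> below.
\<close>

definition is_levi_civita ::
  "(real^'n \<Rightarrow> real^'n \<Rightarrow> real^'n) \<Rightarrow> (real^'n \<Rightarrow> real^'n \<Rightarrow> real) \<Rightarrow>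
   (real^'n \<Rightarrow> real^'n \<Rightarrow> real^'n) \<Rightarrow> bool" where
  "is_levi_civita br g nabla \<longleftrightarrow>
     bilinear nabla \<and>
     (\<forall>x y. nabla x y - nabla y x = br x y) \<and>
     (\<forall>x y z. g (nabla x y) z + g y (nabla x z) = 0)"

definition connection ::
  "(real^'n \<Rightarrow> real^'n \<Rightarrow> real^'n) \<Rightarrow> (real^'n \<Rightarrow> real^'n \<Rightarrow> real) \<Rightarrow>
   real^'n \<Rightarrow> real^'n \<Rightarrow> real^'n" where
  "connection br g = (THE nabla. is_levi_civita br g nabla)"

definition curvature ::
  "(real^'n \<Rightarrow> real^'n \<Rightarrow> real^'n) \<Rightarrow> (real^'n \<Rightarrow> real^'n \<Rightarrow> real) \<Rightarrow>
   real^'n \<Rightarrow> real^'n \<Rightarrow> real^'n \<Rightarrow> real^'n" where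
  "curvature br g x y z =
     connection br g x (connection br g y z) - connection br g y (connection br g x z)
       - connection br g (br x y) z"

definition ricci ::
  "(real^'n \<Rightarrow> real^'n \<Rightarrow> real^'n) \<Rightarrow> (real^'n \<Rightarrow> real^'n \<Rightarrow> real) \<Rightarrow>
   real^'n \<Rightarrow> real^'n \<Rightarrow> real" where
  "ricci br g x y = trace (matrix (\<lambda>z. curvature br g z x y))"

definition solutions ::
  "(real^3 \<Rightarrow> real^3 \<Rightarrow> real) \<Rightarrow> ((real^3 \<Rightarrow> real^3 \<Rightarrow> real) \<times> real) set" where
  "solutions T =
     {(g, c). left_invariant_metric g \<and> c > 0 \<and> (\<forall>x y. ricci e11_bracket g x y = c * T x y)}"

definition scaling ::
  "(((real^3 \<Rightarrow> real^3 \<Rightarrow> real) \<times> real) \<times> ((real^3 \<Rightarrow> real^3 \<Rightarrow> real) \<times> real)) set" where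
  "scaling = {((g, c), (g', c')). c' = c \<and> (\<exists>a>0. \<forall>x y. g' x y = a * g x y)}"

lemma e11_bracket_components:
  "e11_bracket x y $ 1 = 2 * (x $ 2 * y $ 3 - x $ 3 * y $ 2)"
  "e11_bracket x y $ 2 = - 2 * (x $ 3 * y $ 1 - x $ 1 * y $ 3)"
  "e11_bracket x y $ 3 = 0"
  by (simp_all add: e11_bracket_def levi_civita_symbol_def e11_lambda_def sum_3 axis_def
      vector_3 algebra_simps)

lemma bilinear_e11_bracket: "bilinear e11_bracket"
  unfolding bilinear_def
  by (auto intro!: linearI simp: vec_eq_iff forall_3 e11_bracket_components algebra_simps)

lemma e11_bracket_alternating: "e11_bracket x x = 0"
  by (simp add: vec_eq_iff forall_3 e11_bracket_components)

lemma e11_bracket_jacobi: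
  "e11_bracket x (e11_bracket y z) + e11_bracket y (e11_bracket z x)
     + e11_bracket z (e11_bracket x y) = 0"
  by (simp add: vec_eq_iff forall_3 e11_bracket_components algebra_simps)

lemma e11_bracket_skew: "e11_bracket x y = - e11_bracket y x"
  by (simp add: vec_eq_iff forall_3 e11_bracket_components algebra_simps)

lemma e11_unimodular: "trace (matrix (e11_bracket x)) = 0"
  by (simp add: trace_def matrix_def sum_3 e11_bracket_components axis_def)

lemma e11_basis_axis: "e11_basis (\<lambda>i. axis i 1)"
proof -
  have r: "range (\<lambda>i::3. axis i (1::real)) = Basis"
    by (auto simp: Basis_vec_def)
  show ?thesis
    unfolding e11_basis_def r
  proof (intro conjI)
    show "inj (\<lambda>i::3. axis i (1::real))" by (simp add: inj_def axis_eq_axis)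
    show "\<forall>i j. e11_bracket (axis i 1) (axis j 1) =
        (\<Sum>k\<in>UNIV. (levi_civita_symbol i j k * e11_lambda $ k) *\<^sub>R axis k 1)"
      by (simp add: e11_bracket_def sum_3 forall_3 axis_def)
  qed (simp_all add: independent_Basis)
qed

lemma equiv_scaling: "equiv UNIV scaling"
proof (rule equivI)
  show "refl scaling"
    by (auto simp: refl_on_def scaling_def intro!: exI[of _ "1::real"])
  show "sym scaling"
  proof (rule symI)
    fix p q assume "(p, q) \<in> scaling"
    then obtain g c g' a where *: "p = (g, c)" "q = (g', c)" "a > 0" "\<forall>x y. g' x y = a * g x y"
      by (cases p; cases q) (auto simp: scaling_def)
    then have "\<forall>x y. g x y = inverse a * g' x y" "inverse a > 0" by auto
    with * show "(q, p) \<in> scaling" unfolding scaling_def by blast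
  qed
  show "trans scaling"
  proof (rule transI)
    fix p q r assume "(p, q) \<in> scaling" "(q, r) \<in> scaling"
    then obtain g c g' g'' a b where *: "p = (g, c)" "r = (g'', c)" "a > 0" "b > 0"
       "\<forall>x y. g' x y = a * g x y" "\<forall>x y. g'' x y = b * g' x y"
      by (cases p; cases q; cases r) (auto simp: scaling_def)
    then have "\<forall>x y. g'' x y = (b * a) * g x y" "b * a > 0" by auto
    with * show "(p, r) \<in> scaling" unfolding scaling_def by blast
  qed
qed simp

lemma metric_nondegenerate:
  assumes "left_invariant_metric g" "\<And>z. g u z = g v z"
  shows "u = v"
proof (rule ccontr)
  assume "u \<noteq> v"
  then have "g (u - v) (u - v) > 0" using assms(1) by (simp add: left_invariant_metric_def)
  moreover have "g (u - v) (u - v) = 0"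
    using assms(1) assms(2)[of "u - v"] by (simp add: left_invariant_metric_def bilinear_lsub)
  ultimately show False by simp
qed

lemma metric_representation:
  fixes g :: "real^'n \<Rightarrow> real^'n \<Rightarrow> real"
  assumes g: "left_invariant_metric g" and f: "linear f"
  shows "\<exists>u. \<forall>z. g u z = f z"
proof -
  have bl: "bilinear g" using g by (simp add: left_invariant_metric_def)
  define F where "F u = (\<chi> i. g u (axis i 1))" for u
  have expand: "h z = (\<Sum>i\<in>UNIV. z $ i * h (axis i 1))" if "linear h"
    for h :: "real^'n \<Rightarrow> real" and z
  proof -
    have "h z = h (\<Sum>i\<in>UNIV. z $ i *\<^sub>R axis i 1)"
      by (simp add: basis_expansion flip: scalar_mult_eq_scaleR)
    also have "\<dots> = (\<Sum>i\<in>UNIV. z $ i * h (axis i 1))"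
      using that by (simp add: linear_sum linear_scale)
    finally show ?thesis .
  qed
  have lg: "linear (g u)" for u using bl by (simp add: bilinear_def)
  have "linear F"
    unfolding F_def
    by (rule linearI)
       (simp_all add: vec_eq_iff bilinear_ladd[OF bl] bilinear_lmul[OF bl])
  moreover have "inj F"
  proof (rule injI)
    fix u v assume "F u = F v"
    then have "g u (axis i 1) = g v (axis i 1)" for i
      by (simp add: F_def vec_eq_iff)
    then have "g u z = g v z" for z
      using expand[OF lg[of u], of z] expand[OF lg[of v], of z] by simp
    then show "u = v" using metric_nondegenerate[OF g] by blast
  qed
  ultimately have "surj F" using linear_injective_imp_surjective by blast
  then obtain u where u: "F u = (\<chi> i. f (axis i 1))" by (metis surjD)
  then have "g u (axis i 1) = f (axis i 1)" for i by (simp add: F_def vec_eq_iff)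
  then have "g u z = f z" for z
    using expand[OF lg[of u], of z] expand[OF f, of z] by simp
  then show ?thesis by blast
qed

lemma koszul:
  assumes g: "left_invariant_metric g" and n: "is_levi_civita br g nabla"
  shows "2 * g (nabla x y) z = g (br x y) z - g (br y z) x + g (br z x) y"
proof -
  have bl: "bilinear g" and sym: "\<And>x y. g x y = g y x" using g by (auto simp: left_invariant_metric_def)
  have tor: "br x y = nabla x y - nabla y x" for x y using n by (simp add: is_levi_civita_def)
  have comp: "g (nabla x y) z = - g (nabla x z) y" for x y z
    using n sym[of y "nabla x z"] by (simp add: is_levi_civita_def add_eq_0_iff)
  show ?thesis
    unfolding tor bilinear_lsub[OF bl]
    using comp[of x y z] comp[of y x z] comp[of z x y] by simp
qed

lemma is_levi_civita_ex1:
  fixes g :: "real^'n \<Rightarrow> real^'n \<Rightarrow> real"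
  assumes g: "left_invariant_metric g" and br: "bilinear br" and skew: "\<And>x y. br x y = - br y x"
  shows "\<exists>!nabla. is_levi_civita br g nabla"
proof -
  have bl: "bilinear g" and sym: "\<And>x y. g x y = g y x" using g by (auto simp: left_invariant_metric_def)
  note lins = bilinear_ladd[OF bl] bilinear_radd[OF bl] bilinear_lmul[OF bl] bilinear_rmul[OF bl]
    bilinear_ladd[OF br] bilinear_radd[OF br] bilinear_lmul[OF br] bilinear_rmul[OF br]
    bilinear_lneg[OF bl] bilinear_rneg[OF bl] bilinear_lsub[OF bl] bilinear_rsub[OF bl]
  define K where "K x y z = (g (br x y) z - g (br y z) x + g (br z x) y) / 2" for x y z
  have "linear (K x y)" for x y
    unfolding K_def by (rule linearI) (simp_all add: lins field_simps)
  then have "\<exists>u. \<forall>z. g u z = K x y z" for x y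
    using metric_representation[OF g] by blast
  then obtain D where D: "\<And>x y z. g (D x y) z = K x y z" by metis
  have "is_levi_civita br g D"
    unfolding is_levi_civita_def
  proof (intro conjI allI)
    show "bilinear D"
      unfolding bilinear_def
    proof (intro conjI allI linearI)
      fix x y y' show "D x (y + y') = D x y + D x y'"
        by (rule metric_nondegenerate[OF g]) (simp add: lins D, simp add: K_def lins field_simps)
    next
      fix x y c show "D x (c *\<^sub>R y) = c *\<^sub>R D x y"
        by (rule metric_nondegenerate[OF g]) (simp add: lins D, simp add: K_def lins field_simps)
    next
      fix x x' y show "D (x + x') y = D x y + D x' y"
        by (rule metric_nondegenerate[OF g]) (simp add: lins D, simp add: K_def lins field_simps)
    next
      fix x y c show "D (c *\<^sub>R x) y = c *\<^sub>R D x y"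
        by (rule metric_nondegenerate[OF g]) (simp add: lins D, simp add: K_def lins field_simps)
    qed
  next
    fix x y show "D x y - D y x = br x y"
    proof (rule metric_nondegenerate[OF g])
      fix z show "g (D x y - D y x) z = g (br x y) z"
        using skew[of y x] skew[of z x] skew[of z y]
        by (simp add: lins D) (simp add: K_def lins field_simps)
    qed
  next
    fix x y z show "g (D x y) z + g y (D x z) = 0"
      using skew[of y x] skew[of z x] skew[of z y] sym[of y "D x z"]
      by (simp add: D) (simp add: K_def lins field_simps)
  qed
  moreover have "n1 = n2" if "is_levi_civita br g n1" "is_levi_civita br g n2" for n1 n2
  proof (intro ext)
    fix x y show "n1 x y = n2 x y"
    proof (rule metric_nondegenerate[OF g])
      fix z show "g (n1 x y) z = g (n2 x y) z"
        using koszul[OF g that(1), of x y z] koszul[OF g that(2), of x y z] by simp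
    qed
  qed
  ultimately show ?thesis by blast
qed

lemma is_levi_civita_connection:
  assumes "left_invariant_metric g" "bilinear br" "\<And>x y. br x y = - br y x"
  shows "is_levi_civita br g (connection br g)"
  unfolding connection_def by (rule theI'[OF is_levi_civita_ex1[OF assms]])

end

theory Submission
  imports Defs
begin

text \<open>
  The Ricci tensor is natural under automorphisms of the Lie algebra, and the bases that realise
  the structure constants \<open>(2, -2, 0)\<close> are exactly the images of the standard basis under
  automorphisms (\<open>e11_basis_iff_automorphism\<close>). Every left-invariant metric is diagonal in some
  such basis (\<open>metric_diagonalisable\<close>), and for a metric with diagonal entries
  \<open>x\<^sub>1, x\<^sub>2, x\<^sub>3\<close> the Ricci tensor is diagonal in the same basis, with entries

  \<open>2 (x\<^sub>1\<^sup>2 - x\<^sub>2\<^sup>2) / (x\<^sub>2 x\<^sub>3)\<close>,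
  \<open>2 (x\<^sub>2\<^sup>2 - x\<^sub>1\<^sup>2) / (x\<^sub>1 x\<^sub>3)\<close>,
  \<open>- 2 (x\<^sub>1 + x\<^sub>2)\<^sup>2 / (x\<^sub>1 x\<^sub>2)\<close>.

  Necessity of the sign conditions can be read off: \<open>T\<^sub>1\<close> and \<open>T\<^sub>2\<close> both vanish if
  \<open>x\<^sub>1 = x\<^sub>2\<close>, and otherwise they have opposite signs, with a sum that is a positive multiple of
  \<open>(x\<^sub>1 - x\<^sub>2)\<^sup>2\<close>.
  Conversely the first two equations force \<open>x\<^sub>1 / x\<^sub>2 = - T\<^sub>1 / T\<^sub>2\<close> when
  \<open>T\<^sub>1 T\<^sub>2 < 0\<close>; the third then fixes \<open>c\<close> and the first fixes \<open>x\<^sub>3\<close>, up to scaling,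
  and the conditions \<open>T\<^sub>3 < 0\<close> and \<open>T\<^sub>1 + T\<^sub>2 > 0\<close> make these values positive.
  When \<open>T\<^sub>1 = T\<^sub>2 = 0\<close> they say \<open>x\<^sub>1 = x\<^sub>2\<close>, the third gives
  \<open>c T\<^sub>3 = - 8\<close>, and \<open>x\<^sub>3\<close> remains free.

  For uniqueness the metric of a second solution must be compared with the first one, but it is
  diagonal only in a basis of its own. Two bases with the prescribed brackets differ by a very
  restricted matrix (\<open>e11_basis_change\<close>). If \<open>T\<close> is diagonal in both and
  \<open>T\<^sub>1 + T\<^sub>2\<close> and \<open>T\<^sub>1 T\<^sub>2\<close> are nonzero, the bases agree up to scalars
  and a swap of the first two vectors, so that every solution is diagonal in every basis that
  diagonalises \<open>T\<close> (\<open>diagonal_in_transfer\<close>). In the degenerate case this fails, but the change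
  of basis still preserves \<open>T\<^sub>1 = 0\<close> and \<open>T\<^sub>3\<close>, which is all that the value of \<open>c\<close> requires.
\<close>

section \<open>Naturality of the Ricci tensor\<close>

lemma connection_eqI:
  fixes g :: "real^'n \<Rightarrow> real^'n \<Rightarrow> real"
  assumes "left_invariant_metric g" "bilinear br" "\<And>x y. br x y = - br y x"
    and "is_levi_civita br g D"
  shows "connection br g = D"
  using is_levi_civita_ex1[OF assms(1-3)] is_levi_civita_connection[OF assms(1-3)] assms(4)
  by blast

lemma left_invariant_metric_pullback:
  assumes g: "left_invariant_metric g" and f: "linear f" "inj f"
  shows "left_invariant_metric (\<lambda>x y. g (f x) (f y))"
proof -
  have "bilinear g" using g by (simp add: left_invariant_metric_def)
  then have "bilinear (\<lambda>x y. g (f x) (f y))"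
    using f(1) unfolding bilinear_def
    by (auto intro!: linearI simp: linear_add linear_scale
        \<open>bilinear g\<close>[THEN bilinear_ladd] \<open>bilinear g\<close>[THEN bilinear_lmul])
  moreover have "f x \<noteq> 0" if "x \<noteq> 0" for x
    using that linear_injective_0[OF f(1)] f(2) by blast
  ultimately show ?thesis using g by (simp add: left_invariant_metric_def)
qed

lemma
  fixes g :: "real^'n \<Rightarrow> real^'n \<Rightarrow> real"
  assumes g: "left_invariant_metric g" and br: "bilinear br" "\<And>x y. br x y = - br y x"
  shows linear_curvature: "linear (\<lambda>z. curvature br g z x y)"
    and bilinear_ricci: "bilinear (ricci br g)"
proof -
  have D: "bilinear (connection br g)"
    using is_levi_civita_connection[OF assms] by (simp add: is_levi_civita_def)
  note lins = bilinear_ladd[OF D] bilinear_radd[OF D] bilinear_lmul[OF D] bilinear_rmul[OF D]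
    bilinear_lsub[OF D] bilinear_rsub[OF D]
    bilinear_ladd[OF br(1)] bilinear_radd[OF br(1)] bilinear_lmul[OF br(1)] bilinear_rmul[OF br(1)]
  show "linear (\<lambda>z. curvature br g z x y)"
    by (rule linearI) (simp_all add: curvature_def lins algebra_simps)
  show "bilinear (ricci br g)"
    unfolding bilinear_def
    by (auto intro!: linearI simp: ricci_def trace_def matrix_def curvature_def lins algebra_simps
        sum.distrib sum_distrib_left sum_subtractf)
qed

text \<open>
  Conjugating the Levi-Civita connection of \<open>g\<close> by the automorphism \<open>f\<close> gives a torsion-free
  connection compatible with the pulled-back metric, hence its Levi-Civita connection. The
  curvature operators are therefore conjugate and have the same trace.
\<close>

lemma ricci_pullback:
  fixes g :: "real^'n \<Rightarrow> real^'n \<Rightarrow> real"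
  assumes g: "left_invariant_metric g" and br: "bilinear br" "\<And>x y. br x y = - br y x"
    and f: "linear f" "inj f" and hom: "\<And>x y. f (br x y) = br (f x) (f y)"
  shows "ricci br (\<lambda>x y. g (f x) (f y)) x y = ricci br g (f x) (f y)"
proof -
  define D where "D = connection br g"
  have D: "bilinear D" "\<And>x y. D x y - D y x = br x y"
    "\<And>x y z. g (D x y) z + g y (D x z) = 0"
    using is_levi_civita_connection[OF g br] by (auto simp: is_levi_civita_def D_def)
  obtain h where h: "linear h" "\<And>x. h (f x) = x" "\<And>x. f (h x) = x"
    using linear_injective_isomorphism[OF f] by blast
  note lins = bilinear_ladd[OF D(1)] bilinear_radd[OF D(1)] bilinear_lmul[OF D(1)]
    bilinear_rmul[OF D(1)] linear_add[OF f(1)] linear_scale[OF f(1)]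
    linear_add[OF h(1)] linear_scale[OF h(1)]
  have "is_levi_civita br (\<lambda>x y. g (f x) (f y)) (\<lambda>x y. h (D (f x) (f y)))"
    unfolding is_levi_civita_def
  proof (intro conjI allI)
    show "bilinear (\<lambda>x y. h (D (f x) (f y)))"
      unfolding bilinear_def by (auto intro!: linearI simp: lins)
    show "h (D (f x) (f y)) - h (D (f y) (f x)) = br x y" for x y
      using D(2)[of "f x" "f y"] h(2)[of "br x y"]
      by (simp add: hom flip: linear_diff[OF h(1)])
    show "g (f (h (D (f x) (f y)))) (f z) + g (f y) (f (h (D (f x) (f z)))) = 0" for x y z
      using D(3) by (simp add: h)
  qed
  then have "connection br (\<lambda>x y. g (f x) (f y)) = (\<lambda>x y. h (D (f x) (f y)))"
    by (rule connection_eqI[OF left_invariant_metric_pullback[OF g f] br])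
  then have "curvature br (\<lambda>x y. g (f x) (f y)) z x y = h (curvature br g (f z) (f x) (f y))" for z
    by (simp add: curvature_def h hom linear_diff[OF h(1)] flip: D_def)
  then have "(\<lambda>z. curvature br (\<lambda>x y. g (f x) (f y)) z x y)
      = h \<circ> ((\<lambda>z. curvature br g z (f x) (f y)) \<circ> f)"
    by (simp add: fun_eq_iff)
  then have "ricci br (\<lambda>x y. g (f x) (f y)) x y
      = trace (matrix h ** (matrix (\<lambda>z. curvature br g z (f x) (f y)) ** matrix f))"
    by (simp add: ricci_def matrix_compose linear_compose h(1) f(1) linear_curvature[OF g br])
  also have "\<dots> = trace (matrix (\<lambda>z. curvature br g z (f x) (f y)) ** (matrix f ** matrix h))"
    by (subst trace_mul_sym) (simp add: matrix_mul_assoc)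
  also have "matrix f ** matrix h = mat 1"
  proof -
    have "f \<circ> h = id" by (simp add: fun_eq_iff h)
    then show ?thesis using matrix_compose[OF h(1) f(1)] by (simp add: matrix_id_mat_1)
  qed
  finally show ?thesis by (simp add: ricci_def)
qed

section \<open>Metrics that are diagonal in the standard basis\<close>

definition diagonal_form :: "real \<Rightarrow> real \<Rightarrow> real \<Rightarrow> real^3 \<Rightarrow> real^3 \<Rightarrow> real" where
  "diagonal_form a b c x y = a * (x $ 1 * y $ 1) + b * (x $ 2 * y $ 2) + c * (x $ 3 * y $ 3)"

lemma left_invariant_metric_diagonal_form:
  assumes "a > 0" "b > 0" "c > 0"
  shows "left_invariant_metric (diagonal_form a b c)"
  unfolding left_invariant_metric_def
proof (intro conjI allI impI)
  show "bilinear (diagonal_form a b c)"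
    unfolding bilinear_def by (auto intro!: linearI simp: diagonal_form_def algebra_simps)
  show "diagonal_form a b c x y = diagonal_form a b c y x" for x y
    by (simp add: diagonal_form_def mult.commute)
  fix x :: "real^3" assume "x \<noteq> 0"
  then have "x $ 1 \<noteq> 0 \<or> x $ 2 \<noteq> 0 \<or> x $ 3 \<noteq> 0" by (simp add: vec_eq_iff forall_3)
  then have "0 < a * (x $ 1 * x $ 1) \<or> 0 < b * (x $ 2 * x $ 2) \<or> 0 < c * (x $ 3 * x $ 3)"
    using assms by (simp add: zero_less_mult_iff, linarith)
  moreover have "0 \<le> a * (x $ 1 * x $ 1)" "0 \<le> b * (x $ 2 * x $ 2)" "0 \<le> c * (x $ 3 * x $ 3)"
    using assms by auto
  ultimately show "diagonal_form a b c x x > 0" unfolding diagonal_form_def by linarith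
qed

text \<open>
  The Levi-Civita connection comes from the Koszul formula: for the standard basis, the component
  of \<open>\<nabla> e\<^sub>i e\<^sub>j\<close> along \<open>e\<^sub>k\<close> is
  \<open>\<epsilon>\<^sub>i\<^sub>j\<^sub>k (\<lambda>\<^sub>k x\<^sub>k - \<lambda>\<^sub>i x\<^sub>i + \<lambda>\<^sub>j x\<^sub>j) / (2 x\<^sub>k)\<close>,
  where \<open>(x\<^sub>1, x\<^sub>2, x\<^sub>3) = (a, b, c)\<close> and \<open>\<lambda> = (2, -2, 0)\<close>.
\<close>

lemma ricci_diagonal_form:
  assumes "a > 0" "b > 0" "c > 0"
  shows "ricci e11_bracket (diagonal_form a b c) =
    diagonal_form (2 * (a\<^sup>2 - b\<^sup>2) / (b * c)) (2 * (b\<^sup>2 - a\<^sup>2) / (a * c)) (- 2 * (a + b)\<^sup>2 / (a * b))"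
proof -
  define D :: "real^3 \<Rightarrow> real^3 \<Rightarrow> real^3" where "D x y = vector
    [(a + b) / a * (x $ 2 * y $ 3) - (a - b) / a * (x $ 3 * y $ 2),
     (a + b) / b * (x $ 1 * y $ 3) + (a - b) / b * (x $ 3 * y $ 1),
     - (a + b) / c * (x $ 1 * y $ 2 + x $ 2 * y $ 1)]" for x y
  have "is_levi_civita e11_bracket (diagonal_form a b c) D"
    unfolding is_levi_civita_def
  proof (intro conjI allI)
    show "bilinear D"
      unfolding bilinear_def
      by (auto intro!: linearI simp: D_def vec_eq_iff forall_3 vector_3 algebra_simps
          add_divide_distrib diff_divide_distrib)
    show "D x y - D y x = e11_bracket x y" for x y
      using assms
      by (simp add: D_def vec_eq_iff forall_3 vector_3 e11_bracket_components field_simps)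
    show "diagonal_form a b c (D x y) z + diagonal_form a b c y (D x z) = 0" for x y z
      using assms by (simp add: D_def diagonal_form_def vector_3 field_simps)
  qed
  then have D: "connection e11_bracket (diagonal_form a b c) = D"
    by (rule connection_eqI[OF left_invariant_metric_diagonal_form[OF assms]
          bilinear_e11_bracket e11_bracket_skew])
  show ?thesis
    using assms
    by (simp add: fun_eq_iff ricci_def trace_def matrix_def sum_3 curvature_def D D_def vector_3
        e11_bracket_components axis_def diagonal_form_def)
      (simp add: field_simps power2_eq_square)
qed

section \<open>Bases with the prescribed brackets as automorphisms\<close>

definition combination :: "(3 \<Rightarrow> real^3) \<Rightarrow> real^3 \<Rightarrow> real^3" where
  "combination V x = (\<Sum>i\<in>UNIV. x $ i *\<^sub>R V i)"

lemma linear_combination: "linear (combination V)"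
  by (rule linearI) (simp_all add: combination_def scaleR_left_distrib sum.distrib scaleR_sum_right)

lemma combination_axis: "combination V (axis i 1) = V i"
  by (simp add: combination_def axis_def if_distrib[where f = "\<lambda>t. t *\<^sub>R _"] cong: if_cong)

text \<open>
  The brackets of the \<open>V i\<close> have the same structure constants as those of the standard basis, so
  the linear map that sends the standard basis to \<open>V\<close> respects the bracket. This lets every
  computation in the basis \<open>V\<close> be pulled back to the standard basis.
\<close>

lemma e11_basis_iff_automorphism:
  "e11_basis V \<longleftrightarrow> inj (combination V) \<and>
     (\<forall>x y. combination V (e11_bracket x y) = e11_bracket (combination V x) (combination V y))"
proof -
  have r: "range V = combination V ` Basis"
  proof -
    have "Basis = range (\<lambda>i::3. axis i (1::real))" by (auto simp: Basis_vec_def)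
    then have "combination V ` Basis = (\<lambda>i. combination V (axis i 1)) ` UNIV"
      by (metis image_image)
    then show ?thesis by (simp add: combination_axis)
  qed
  note B = bilinear_e11_bracket
  have br: "(\<forall>x y. combination V (e11_bracket x y) = e11_bracket (combination V x) (combination V y))
    \<longleftrightarrow> (\<forall>i j. e11_bracket (V i) (V j) = (\<Sum>k\<in>UNIV. (levi_civita_symbol i j k * e11_lambda $ k) *\<^sub>R V k))"
    (is "?L \<longleftrightarrow> ?R")
  proof
    assume ?L
    show ?R
    proof (intro allI)
      fix i j
      have "e11_bracket (V i) (V j) = combination V (e11_bracket (axis i 1) (axis j 1))"
        using \<open>?L\<close> by (simp add: combination_axis)
      also have "e11_bracket (axis i 1) (axis j 1)
          = (\<Sum>k\<in>UNIV. (levi_civita_symbol i j k * e11_lambda $ k) *\<^sub>R axis k 1)"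
        using e11_basis_axis by (simp add: e11_basis_def)
      finally show "e11_bracket (V i) (V j)
          = (\<Sum>k\<in>UNIV. (levi_civita_symbol i j k * e11_lambda $ k) *\<^sub>R V k)"
        by (simp add: linear_sum[OF linear_combination] linear_scale[OF linear_combination]
            combination_axis)
    qed
  next
    assume R: ?R
    show ?L
    proof (intro allI)
      fix x y
      have "e11_bracket (combination V x) (combination V y)
          = (\<Sum>i\<in>UNIV. \<Sum>j\<in>UNIV. (x $ i * y $ j) *\<^sub>R e11_bracket (V i) (V j))"
        by (simp add: combination_def sum_3 bilinear_ladd[OF B] bilinear_radd[OF B]
            bilinear_lmul[OF B] bilinear_rmul[OF B] algebra_simps)
      also have "\<dots> = combination V (e11_bracket x y)"
        unfolding e11_bracket_def[of x y]
        by (simp add: R linear_sum[OF linear_combination] linear_scale[OF linear_combination]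
            combination_axis scaleR_sum_right)
      finally show "combination V (e11_bracket x y) = e11_bracket (combination V x) (combination V y)"
        by simp
    qed
  qed
  have "inj V \<and> independent (range V) \<and> span (range V) = UNIV \<longleftrightarrow> inj (combination V)"
  proof
    assume V: "inj V \<and> independent (range V) \<and> span (range V) = UNIV"
    then have "surj (combination V)"
      using linear_span_image[OF linear_combination, of V Basis] by (simp add: r)
    then show "inj (combination V)"
      using linear_combination linear_surjective_imp_injective by blast
  next
    assume inj: "inj (combination V)"
    then have "inj V"
      by (metis (mono_tags, lifting) combination_axis injD injI axis_eq_axis zero_neq_one)
    moreover have "independent (range V)"
      unfolding r using linear_independent_injective_image[OF linear_combination independent_Basis]
        inj by (simp add: inj_on_subset)
    moreover have "span (range V) = UNIV"
      using linear_injective_imp_surjective[OF linear_combination inj]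
        linear_span_image[OF linear_combination, of V Basis] by (simp add: r)
    ultimately show "inj V \<and> independent (range V) \<and> span (range V) = UNIV" by blast
  qed
  then show ?thesis using br unfolding e11_basis_def by blast
qed

section \<open>Tensors that are diagonal in a given basis\<close>

lemma diagonal_in_iff:
  assumes "bilinear T"
  shows "diagonal_in V T T1 T2 T3 \<longleftrightarrow>
    (\<lambda>x y. T (combination V x) (combination V y)) = diagonal_form T1 T2 T3"
proof
  assume "diagonal_in V T T1 T2 T3"
  then show "(\<lambda>x y. T (combination V x) (combination V y)) = diagonal_form T1 T2 T3"
    by (simp add: fun_eq_iff diagonal_in_def combination_def sum_3 diagonal_form_def forall_3 vector_3
       bilinear_ladd[OF assms] bilinear_radd[OF assms] bilinear_lmul[OF assms]
       bilinear_rmul[OF assms] algebra_simps)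
next
  assume "(\<lambda>x y. T (combination V x) (combination V y)) = diagonal_form T1 T2 T3"
  then have "T (V i) (V j) = diagonal_form T1 T2 T3 (axis i 1) (axis j 1)" for i j
    by (metis combination_axis)
  then show "diagonal_in V T T1 T2 T3"
    by (simp add: diagonal_in_def forall_3 diagonal_form_def axis_def vector_3)
qed

lemma diagonal_in_unique:
  assumes "bilinear S" "bilinear T" "e11_basis V"
    and "diagonal_in V S T1 T2 T3" "diagonal_in V T T1 T2 T3"
  shows "S = T"
proof (intro ext)
  fix x y
  have "surj (combination V)"
    using assms(3) linear_injective_imp_surjective[OF linear_combination]
    by (simp add: e11_basis_iff_automorphism)
  then obtain u v where "x = combination V u" "y = combination V v" by (metis surjD)
  then show "S x y = T x y"
    using assms(4,5) unfolding diagonal_in_iff[OF assms(1)] diagonal_in_iff[OF assms(2)]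
    by (simp add: fun_eq_iff)
qed

lemma diagonal_in_scale:
  assumes "diagonal_in V T T1 T2 T3"
  shows "diagonal_in V (\<lambda>x y. c * T x y) (c * T1) (c * T2) (c * T3)"
  using assms by (simp add: diagonal_in_def forall_3 vector_3)

lemma bilinear_scale:
  assumes "bilinear T"
  shows "bilinear (\<lambda>x y. c * T x y :: real)"
  unfolding bilinear_def
  by (auto intro!: linearI simp: bilinear_ladd[OF assms] bilinear_radd[OF assms]
      bilinear_lmul[OF assms] bilinear_rmul[OF assms] algebra_simps)

lemma diagonal_in_coefficients:
  assumes "diagonal_in V T T1 T2 T3" "diagonal_in V T S1 S2 S3"
  shows "T1 = S1" "T2 = S2" "T3 = S3"
proof -
  have "vector [T1, T2, T3] $ i = (vector [S1, S2, S3] $ i :: real)" for i :: 3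
    using assms unfolding diagonal_in_def by (metis (full_types))
  from this[of 1] this[of 2] this[of 3] show "T1 = S1" "T2 = S2" "T3 = S3"
    by (simp_all add: vector_3)
qed

lemma e11_basis_nonzero:
  assumes "e11_basis V"
  shows "V i \<noteq> 0"
  using assms linear_injective_0[OF linear_combination] combination_axis[of V i]
  by (metis axis_eq_0_iff e11_basis_iff_automorphism zero_neq_one)

lemma diagonal_metric_exists:
  assumes V: "e11_basis V" and "a > 0" "b > 0" "c > 0"
  shows "\<exists>g. left_invariant_metric g \<and> diagonal_in V g a b c"
proof -
  have inj: "inj (combination V)" using V by (simp add: e11_basis_iff_automorphism)
  obtain h where h: "linear h" "\<And>x. h (combination V x) = x" "\<And>x. combination V (h x) = x"
    using linear_injective_isomorphism[OF linear_combination inj] by blast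
  have "inj h" by (metis h(3) injI)
  have m: "left_invariant_metric (\<lambda>x y. diagonal_form a b c (h x) (h y))"
    by (rule left_invariant_metric_pullback)
       (simp_all add: h \<open>inj h\<close> left_invariant_metric_diagonal_form assms)
  then have "diagonal_in V (\<lambda>x y. diagonal_form a b c (h x) (h y)) a b c"
    by (subst diagonal_in_iff) (simp_all add: h left_invariant_metric_def)
  with m show ?thesis by blast
qed

lemma diagonal_in_metric_pos:
  assumes V: "e11_basis V" and g: "left_invariant_metric g" "diagonal_in V g a b c"
  shows "a > 0" "b > 0" "c > 0"
proof -
  have "g (V i) (V i) > 0" for i
    using g(1) e11_basis_nonzero[OF V] by (simp add: left_invariant_metric_def)
  then have "vector [a, b, c] $ i > (0::real)" for i :: 3
    using g(2) by (simp add: diagonal_in_def)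
  from this[of 1] this[of 2] this[of 3] show "a > 0" "b > 0" "c > 0"
    by (simp_all add: vector_3)
qed

lemma ricci_diagonal_in:
  assumes V: "e11_basis V" and g: "left_invariant_metric g" "diagonal_in V g a b c"
  shows "diagonal_in V (ricci e11_bracket g)
    (2 * (a\<^sup>2 - b\<^sup>2) / (b * c)) (2 * (b\<^sup>2 - a\<^sup>2) / (a * c)) (- 2 * (a + b)\<^sup>2 / (a * b))"
proof -
  note e11 = bilinear_e11_bracket e11_bracket_skew
  have bl: "bilinear g" using g(1) by (simp add: left_invariant_metric_def)
  have "ricci e11_bracket g (combination V x) (combination V y)
      = ricci e11_bracket (diagonal_form a b c) x y" for x y
    using ricci_pullback[OF g(1) e11 linear_combination, of V x y] V g(2)
    by (simp add: diagonal_in_iff[OF bl] e11_basis_iff_automorphism)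
  then show ?thesis
    using ricci_diagonal_form[OF diagonal_in_metric_pos[OF assms]]
    by (simp add: diagonal_in_iff[OF bilinear_ricci[OF g(1) e11]])
qed

section \<open>Change of basis\<close>

text \<open>
  The vectors \<open>V 1\<close> and \<open>V 2\<close> are multiples of brackets, hence lie in the derived algebra, which is
  spanned by the first two standard vectors. There \<open>V 3\<close> acts as \<open>s\<close> times the third standard
  vector, and applying the two bracket relations in turn multiplies \<open>V 1\<close> by \<open>s\<^sup>2\<close>, so that
  \<open>s\<^sup>2 = 1\<close>.
\<close>

lemma e11_basis_standard_form:
  assumes "e11_basis V"
  obtains a b p q s where "s = 1 \<or> s = - 1" "a\<^sup>2 \<noteq> b\<^sup>2"
    "V 1 = vector [a, b, 0]" "V 2 = vector [s * b, s * a, 0]" "V 3 = vector [p, q, s]"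
proof -
  define a b p q s where "a = V 1 $ 1" "b = V 1 $ 2" "p = V 3 $ 1" "q = V 3 $ 2" "s = V 3 $ 3"
  note d = this
  have inj: "inj (combination V)" using assms by (simp add: e11_basis_iff_automorphism)
  have "\<forall>i j. e11_bracket (V i) (V j)
      = (\<Sum>k\<in>UNIV. (levi_civita_symbol i j k * e11_lambda $ k) *\<^sub>R V k)"
    using assms by (simp add: e11_basis_def)
  then have "e11_bracket (V 2) (V 3) = 2 *\<^sub>R V 1" "e11_bracket (V 3) (V 1) = - 2 *\<^sub>R V 2"
    by (simp_all add: sum_3 levi_civita_symbol_def e11_lambda_def vector_3)
  then have eq: "V 1 $ 3 = 0" "V 2 $ 3 = 0"
    "V 2 $ 2 * s = a" "V 2 $ 1 * s = b" "s * b = V 2 $ 1" "s * a = V 2 $ 2"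
    by (auto simp: vec_eq_iff forall_3 e11_bracket_components d)
  have V: "V 1 = vector [a, b, 0]" "V 2 = vector [s * b, s * a, 0]" "V 3 = vector [p, q, s]"
    using eq by (simp_all add: vec_eq_iff forall_3 vector_3 d)
  have ab: "a \<noteq> 0 \<or> b \<noteq> 0"
    using e11_basis_nonzero[OF assms, of 1] by (auto simp: V vec_eq_iff forall_3 vector_3)
  have "s * (s * a) = a" "s * (s * b) = b" using eq(3-6) by (metis mult.commute)+
  then have "s\<^sup>2 * a = a" "s\<^sup>2 * b = b" by (simp_all only: power2_eq_square mult.assoc)
  then have "s\<^sup>2 = 1" using ab by auto
  then have s: "s = 1 \<or> s = - 1" by (simp add: power2_eq_1_iff)
  have "a\<^sup>2 \<noteq> b\<^sup>2"
  proof
    assume "a\<^sup>2 = b\<^sup>2"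
    \<comment> \<open>Cramer's rule: in general this combination is \<open>(a\<^sup>2 - b\<^sup>2) e\<^sub>1\<close>.\<close>
    then have "combination V (vector [a, - s * b, 0]) = 0"
      using \<open>s\<^sup>2 = 1\<close> by (auto simp: combination_def sum_3 V vec_eq_iff forall_3 vector_3
          power2_eq_square algebra_simps)
    then have "vector [a, - s * b, 0] = (0::real^3)"
      using linear_injective_0[OF linear_combination] inj by blast
    then show False using ab s by (auto simp: vec_eq_iff forall_3 vector_3)
  qed
  with s V that show thesis by blast
qed

text \<open>
  Seen through the automorphism belonging to \<open>V\<close>, the basis \<open>W\<close> has the same brackets again, so its
  coordinates with respect to \<open>V\<close> have the standard form.
\<close>

lemma e11_basis_change:
  assumes V: "e11_basis V" and W: "e11_basis W"
  obtains a b p q s where "s = 1 \<or> s = - 1" "a\<^sup>2 \<noteq> b\<^sup>2"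
    "W 1 = a *\<^sub>R V 1 + b *\<^sub>R V 2" "W 2 = s *\<^sub>R (b *\<^sub>R V 1 + a *\<^sub>R V 2)"
    "W 3 = p *\<^sub>R V 1 + q *\<^sub>R V 2 + s *\<^sub>R V 3"
proof -
  have V': "inj (combination V)"
    "\<And>x y. combination V (e11_bracket x y) = e11_bracket (combination V x) (combination V y)"
    using V by (simp_all add: e11_basis_iff_automorphism)
  obtain h where h: "linear h" "\<And>x. h (combination V x) = x" "\<And>x. combination V (h x) = x"
    using linear_injective_isomorphism[OF linear_combination V'(1)] by blast
  have comp: "combination (\<lambda>i. h (W i)) x = h (combination W x)" for x
    by (simp add: combination_def linear_sum[OF h(1)] linear_scale[OF h(1)])
  have "inj (combination W)" using W by (simp add: e11_basis_iff_automorphism)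
  then have "inj (combination (\<lambda>i. h (W i)))"
    unfolding inj_def comp by (metis h(3))
  moreover have "h (e11_bracket x y) = e11_bracket (h x) (h y)" for x y
    by (metis h(2,3) V'(2))
  ultimately have "e11_basis (\<lambda>i. h (W i))"
    using W unfolding e11_basis_iff_automorphism comp by metis
  then obtain a b p q s where st: "s = 1 \<or> s = - 1" "a\<^sup>2 \<noteq> b\<^sup>2"
    "h (W 1) = vector [a, b, 0]" "h (W 2) = vector [s * b, s * a, 0]" "h (W 3) = vector [p, q, s]"
    by (rule e11_basis_standard_form)
  from st(3-5) have "W 1 = combination V (vector [a, b, 0])"
    "W 2 = combination V (vector [s * b, s * a, 0])" "W 3 = combination V (vector [p, q, s])"
    by (metis h(3))+
  then show thesis
    using that[OF st(1,2)] by (simp add: combination_def sum_3 vector_3 algebra_simps)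
qed

text \<open>
  The derived algebra splits into the two eigenlines of the third standard vector, spanned by
  \<open>X = e\<^sub>1 + e\<^sub>2\<close> and \<open>Y = e\<^sub>1 - e\<^sub>2\<close>. Rescaling \<open>X\<close> and \<open>Y\<close> independently is an automorphism,
  and so is adding an element of the derived algebra to the third vector. The former can be used to
  give \<open>X\<close> and \<open>Y\<close> equal length, which makes half their sum and half their difference orthogonal; the
  latter makes the third vector orthogonal to both.
\<close>

lemma metric_diagonalisable:
  assumes g: "left_invariant_metric g"
  obtains V a b c where "e11_basis V" "diagonal_in V g a b c"
proof -
  have bl: "bilinear g" and sym: "\<And>x y. g x y = g y x"
    and pos: "\<And>x. x \<noteq> 0 \<Longrightarrow> g x x > 0"
    using g by (auto simp: left_invariant_metric_def)
  note lins = bilinear_ladd[OF bl] bilinear_radd[OF bl] bilinear_lmul[OF bl] bilinear_rmul[OF bl]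
    bilinear_lsub[OF bl] bilinear_rsub[OF bl]
  define X Y :: "real^3" where "X = vector [1, 1, 0]" and "Y = vector [1, - 1, 0]"
  have XY: "g X X > 0" "g Y Y > 0"
    by (rule pos, simp add: X_def Y_def vec_eq_iff forall_3 vector_3)+
  \<comment> \<open>With this \<open>u\<close> the vectors \<open>u X\<close> and \<open>Y / u\<close> have the same length.\<close>
  define u where "u = sqrt (sqrt (g Y Y / g X X))"
  have u: "u > 0" and "(u\<^sup>2)\<^sup>2 = g Y Y / g X X" using XY by (simp_all add: u_def)
  then have u4: "u\<^sup>2 * g X X = g Y Y / u\<^sup>2"
    using XY by (simp add: field_simps power2_eq_square)
  define A B where "A = (1/2) *\<^sub>R (u *\<^sub>R X + (1 / u) *\<^sub>R Y)"
    and "B = (1/2) *\<^sub>R (u *\<^sub>R X - (1 / u) *\<^sub>R Y)"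
  have AB: "g A B = 0"
    using u4 u sym[of X Y] by (simp add: A_def B_def lins power2_eq_square algebra_simps)
  define a b where "a = (u + 1 / u) / 2" and "b = (u - 1 / u) / 2"
  have ab: "a\<^sup>2 - b\<^sup>2 = 1" using u by (simp add: a_def b_def field_simps power2_eq_square)
  have A: "A = vector [a, b, 0]" and B: "B = vector [b, a, 0]"
    by (simp_all add: A_def B_def X_def Y_def a_def b_def vec_eq_iff forall_3 vector_3 field_simps)
  have "A \<noteq> 0" "B \<noteq> 0" using ab by (auto simp: A B vec_eq_iff forall_3 vector_3)
  then have gAB: "g A A > 0" "g B B > 0" by (auto intro: pos)
  define E :: "real^3" where "E = vector [0, 0, 1]"
  define C where "C = E - (g E A / g A A) *\<^sub>R A - (g E B / g B B) *\<^sub>R B"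
  have CA: "g C A = 0" "g C B = 0"
    using gAB AB sym[of B A] by (simp_all add: C_def lins)
  define V :: "3 \<Rightarrow> real^3" where "V i = (if i = 1 then A else if i = 2 then B else C)" for i
  have V: "V 1 = A" "V 2 = B" "V 3 = C" by (simp_all add: V_def)
  obtain p q where C: "C = vector [p, q, 1]"
    by (rule that[of "C $ 1" "C $ 2"])
       (simp add: C_def E_def A B vec_eq_iff forall_3 vector_3)
  have cV: "combination V x = vector [a * x $ 1 + b * x $ 2 + p * x $ 3,
      b * x $ 1 + a * x $ 2 + q * x $ 3, x $ 3]" for x
    by (simp add: combination_def sum_3 V A B C vec_eq_iff forall_3 vector_3)
  have "e11_basis V"
    unfolding e11_basis_iff_automorphism
  proof (intro conjI allI)
    show "inj (combination V)"
      unfolding linear_injective_0[OF linear_combination]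
    proof (intro allI impI)
      fix x assume "combination V x = 0"
      then have eqs: "x $ 3 = 0" "a * x $ 1 + b * x $ 2 = 0" "b * x $ 1 + a * x $ 2 = 0"
        by (auto simp: cV vec_eq_iff forall_3 vector_3)
      \<comment> \<open>Cramer's rule; the determinant \<open>a\<^sup>2 - b\<^sup>2\<close> is \<open>1\<close>.\<close>
      have "(a\<^sup>2 - b\<^sup>2) * x $ 1 = a * (a * x $ 1 + b * x $ 2) - b * (b * x $ 1 + a * x $ 2)"
        "(a\<^sup>2 - b\<^sup>2) * x $ 2 = a * (b * x $ 1 + a * x $ 2) - b * (a * x $ 1 + b * x $ 2)"
        by (simp_all add: power2_eq_square algebra_simps)
      then have "x $ 1 = 0" "x $ 2 = 0" using ab eqs by (metis diff_self mult_1 mult_zero_right)+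
      then show "x = 0" using eqs by (simp add: vec_eq_iff forall_3)
    qed
    show "combination V (e11_bracket x y) = e11_bracket (combination V x) (combination V y)" for x y
      by (simp add: cV vec_eq_iff forall_3 vector_3 e11_bracket_components algebra_simps)
  qed
  moreover have "diagonal_in V g (g A A) (g B B) (g C C)"
    using AB CA sym by (simp add: diagonal_in_def forall_3 V vector_3)
  ultimately show thesis by (rule that)
qed

text \<open>
  Write \<open>W\<close> in terms of \<open>V\<close> as in \<open>e11_basis_change\<close>. Since \<open>T (W 1) (W 2) = 0\<close> and
  \<open>T\<^sub>1 + T\<^sub>2 \<noteq> 0\<close>, one of \<open>a\<close> and \<open>b\<close> vanishes. Since \<open>T\<close> is nondegenerate on the derived
  algebra and \<open>W 3\<close> is \<open>T\<close>-orthogonal to it, \<open>W 3\<close> is \<open>V 3\<close> up to sign. So both bases consist of the same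
  three lines.
\<close>

lemma diagonal_in_transfer:
  assumes T: "bilinear T" and V: "e11_basis V" "diagonal_in V T T1 T2 T3"
    and T12: "T1 + T2 \<noteq> 0" "T1 * T2 \<noteq> 0"
    and g: "bilinear g" and W: "e11_basis W" "diagonal_in W T S1 S2 S3" "diagonal_in W g y1 y2 y3"
  shows "\<exists>z1 z2 z3. diagonal_in V g z1 z2 z3"
proof -
  obtain a b p q s where s: "s = 1 \<or> s = - 1" and ab: "a\<^sup>2 \<noteq> b\<^sup>2" and
    w: "W 1 = a *\<^sub>R V 1 + b *\<^sub>R V 2" "W 2 = s *\<^sub>R (b *\<^sub>R V 1 + a *\<^sub>R V 2)"
    "W 3 = p *\<^sub>R V 1 + q *\<^sub>R V 2 + s *\<^sub>R V 3"
    using e11_basis_change[OF V(1) W(1)] by metis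
  note lins = bilinear_ladd[OF T] bilinear_radd[OF T] bilinear_lmul[OF T] bilinear_rmul[OF T]
  note glins = bilinear_lmul[OF g] bilinear_rmul[OF g] bilinear_lneg[OF g] bilinear_rneg[OF g]
  have VT: "T (V 1) (V 1) = T1" "T (V 2) (V 2) = T2" "\<And>i j. i \<noteq> j \<Longrightarrow> T (V i) (V j) = 0"
    using V(2) by (simp_all add: diagonal_in_def vector_3)
  have WT: "T (W 1) (W 2) = 0" "T (W 3) (W 1) = 0" "T (W 3) (W 2) = 0"
    using W(2) by (simp_all add: diagonal_in_def)
  have "s * (a * b * (T1 + T2)) = 0"
    using WT(1) by (simp add: w lins VT algebra_simps)
  then have ab0: "a = 0 \<or> b = 0" using s T12 by auto
  have 1: "p * a * T1 + q * b * T2 = 0"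
    using WT(2) by (simp add: w lins VT algebra_simps)
  have "s * (p * b * T1 + q * a * T2) = 0"
    using WT(3) by (simp add: w lins VT algebra_simps)
  then have 2: "p * b * T1 + q * a * T2 = 0" using s by auto
  have pq: "p = 0" "q = 0" using ab0 1 2 ab T12 by auto
  have gW: "\<And>i j. g (W i) (W j) = (if i = j then vector [y1, y2, y3] $ i else 0)"
    using W(3) by (simp add: diagonal_in_def)
  have V3: "V 3 = s *\<^sub>R W 3" using s by (auto simp: w pq)
  show ?thesis
  proof (cases "b = 0")
    case True
    then have "V 1 = (1 / a) *\<^sub>R W 1" "V 2 = (s / a) *\<^sub>R W 2" using ab s by (auto simp: w)
    then show ?thesis
      by (simp add: diagonal_in_def forall_3 vector_3 glins gW V3)
  next
    case False
    then have "V 2 = (1 / b) *\<^sub>R W 1" "V 1 = (s / b) *\<^sub>R W 2" using ab0 s by (auto simp: w)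
    then show ?thesis
      by (simp add: diagonal_in_def forall_3 vector_3 glins gW V3)
  qed
qed

section \<open>The prescribed Ricci curvature equation\<close>

lemma diagonal_solution_iff:
  assumes T: "bilinear T" "diagonal_in V T T1 T2 T3" and V: "e11_basis V"
    and g: "left_invariant_metric g" "diagonal_in V g x1 x2 x3"
  shows "(g, c) \<in> solutions T \<longleftrightarrow> c > 0 \<and> 2 * (x1\<^sup>2 - x2\<^sup>2) = c * T1 * (x2 * x3) \<and>
    2 * (x2\<^sup>2 - x1\<^sup>2) = c * T2 * (x1 * x3) \<and> - 2 * (x1 + x2)\<^sup>2 = c * T3 * (x1 * x2)"
proof -
  note pos = diagonal_in_metric_pos[OF V g]
  note ric = ricci_diagonal_in[OF V g]
  have "ricci e11_bracket g = (\<lambda>x y. c * T x y) \<longleftrightarrow> 2 * (x1\<^sup>2 - x2\<^sup>2) / (x2 * x3) = c * T1 \<and>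
    2 * (x2\<^sup>2 - x1\<^sup>2) / (x1 * x3) = c * T2 \<and> - 2 * (x1 + x2)\<^sup>2 / (x1 * x2) = c * T3"
    (is "?L \<longleftrightarrow> ?R")
  proof
    assume ?L
    then show ?R using diagonal_in_coefficients[OF ric] diagonal_in_scale[OF T(2), of c] by metis
  next
    assume ?R
    then show ?L
      using diagonal_in_unique[OF bilinear_ricci[OF g(1) bilinear_e11_bracket e11_bracket_skew]
          bilinear_scale[OF T(1)] V ric] diagonal_in_scale[OF T(2), of c] by metis
  qed
  moreover have "?R \<longleftrightarrow> 2 * (x1\<^sup>2 - x2\<^sup>2) = c * T1 * (x2 * x3) \<and>
    2 * (x2\<^sup>2 - x1\<^sup>2) = c * T2 * (x1 * x3) \<and> - 2 * (x1 + x2)\<^sup>2 = c * T3 * (x1 * x2)"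
    using pos
      nonzero_divide_eq_eq[of "x2 * x3" "2 * (x1\<^sup>2 - x2\<^sup>2)" "c * T1"]
      nonzero_divide_eq_eq[of "x1 * x3" "2 * (x2\<^sup>2 - x1\<^sup>2)" "c * T2"]
      nonzero_divide_eq_eq[of "x1 * x2" "- 2 * (x1 + x2)\<^sup>2" "c * T3"]
    by (simp only: mult_eq_0_iff) fastforce
  moreover have "(g, c) \<in> solutions T \<longleftrightarrow> c > 0 \<and> ricci e11_bracket g = (\<lambda>x y. c * T x y)"
    using g(1) by (auto simp: solutions_def fun_eq_iff)
  ultimately show ?thesis by blast
qed


text \<open>A basis that diagonalises \<open>g\<close> diagonalises its Ricci tensor, hence also \<open>T\<close>.\<close>

lemma solution_diagonalisable:
  assumes T: "bilinear T" and gc: "(g, c) \<in> solutions T"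
  obtains W S1 S2 S3 y1 y2 y3 where "e11_basis W" "diagonal_in W T S1 S2 S3"
    "diagonal_in W g y1 y2 y3"
proof -
  have g: "left_invariant_metric g" and c: "c > 0"
    and ric: "ricci e11_bracket g x y = c * T x y" for x y
    using gc by (auto simp: solutions_def)
  obtain W y1 y2 y3 where W: "e11_basis W" "diagonal_in W g y1 y2 y3"
    using metric_diagonalisable[OF g] by blast
  have "T = (\<lambda>x y. (1 / c) * ricci e11_bracket g x y)"
    using c by (simp add: ric)
  then show thesis
    using diagonal_in_scale[OF ricci_diagonal_in[OF W(1) g W(2)], of "1 / c"] W that by metis
qed

text \<open>
  The sum of the first two equations gives \<open>T\<^sub>1 x\<^sub>2 = - T\<^sub>2 x\<^sub>1\<close>, and likewise for \<open>y\<close>, so the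
  ratios \<open>y\<^sub>1 / x\<^sub>1\<close> and \<open>y\<^sub>2 / x\<^sub>2\<close> agree. The third equation is homogeneous of degree two in the
  first two entries and so yields \<open>c' = c\<close>; the first one then yields the ratio of the third
  entries.
\<close>

lemma solutions_diagonal_proportional:
  fixes c c' :: real
  assumes T: "T1 \<noteq> 0" "T3 \<noteq> 0"
    and x: "c > 0" "x1 > 0" "x2 > 0" "x3 > 0" "2 * (x1\<^sup>2 - x2\<^sup>2) = c * T1 * (x2 * x3)"
      "2 * (x2\<^sup>2 - x1\<^sup>2) = c * T2 * (x1 * x3)" "- 2 * (x1 + x2)\<^sup>2 = c * T3 * (x1 * x2)"
    and y: "c' > 0" "y1 > 0" "y2 > 0" "y3 > 0" "2 * (y1\<^sup>2 - y2\<^sup>2) = c' * T1 * (y2 * y3)"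
      "2 * (y2\<^sup>2 - y1\<^sup>2) = c' * T2 * (y1 * y3)" "- 2 * (y1 + y2)\<^sup>2 = c' * T3 * (y1 * y2)"
  shows "c' = c \<and> (\<exists>k>0. y1 = k * x1 \<and> y2 = k * x2 \<and> y3 = k * x3)"
proof -
  define k where "k = y1 / x1"
  have k: "k > 0" "y1 = k * x1" using x y by (simp_all add: k_def)
  have "c * x3 * (T1 * x2 + T2 * x1) = 0" using x(5,6) by (simp add: algebra_simps)
  then have Tx: "T1 * x2 = - T2 * x1" using x by simp
  have "c' * y3 * (T1 * y2 + T2 * y1) = 0" using y(5,6) by (simp add: algebra_simps)
  then have "T1 * y2 = - T2 * y1" using y by simp
  also have "\<dots> = k * (T1 * x2)" unfolding Tx by (simp add: k)
  finally have y2: "y2 = k * x2" using T by (simp add: mult.left_commute)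
  have "c' * T3 * (y1 * y2) = k\<^sup>2 * (c * T3 * (x1 * x2))"
    unfolding x(7)[symmetric] y(7)[symmetric] by (simp add: k y2 power2_eq_square algebra_simps)
  then have c: "c' = c" using T x k by (simp add: k y2 power2_eq_square)
  have "c' * T1 * (y2 * y3) = k\<^sup>2 * (c * T1 * (x2 * x3))"
    unfolding x(5)[symmetric] y(5)[symmetric] by (simp add: k y2 power2_eq_square algebra_simps)
  then have "y3 = k * x3" using T x k by (simp add: c y2 power2_eq_square)
  with c k y2 show ?thesis by blast
qed

lemma solutions_unique_up_to_scaling:
  assumes T: "bilinear T" and V: "e11_basis V" "diagonal_in V T T1 T2 T3"
    and T12: "T1 + T2 \<noteq> 0" "T1 * T2 \<noteq> 0" "T3 \<noteq> 0"
    and sol: "(g, c) \<in> solutions T" "(g', c') \<in> solutions T"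
  shows "c' = c \<and> (\<exists>a>0. \<forall>x y. g' x y = a * g x y)"
proof -
  have g: "left_invariant_metric g" "left_invariant_metric g'"
    using sol by (auto simp: solutions_def)
  then have bl: "bilinear g" "bilinear g'" by (auto simp: left_invariant_metric_def)
  have diag: "\<exists>z1 z2 z3. diagonal_in V h z1 z2 z3" if "(h, d) \<in> solutions T" "bilinear h" for h d
    using solution_diagonalisable[OF T that(1)]
      diagonal_in_transfer[OF T V T12(1,2) that(2)] by metis
  obtain x1 x2 x3 where x: "diagonal_in V g x1 x2 x3" using diag[OF sol(1) bl(1)] by blast
  obtain y1 y2 y3 where y: "diagonal_in V g' y1 y2 y3" using diag[OF sol(2) bl(2)] by blast
  have "c' = c \<and> (\<exists>k>0. y1 = k * x1 \<and> y2 = k * x2 \<and> y3 = k * x3)"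
    using solutions_diagonal_proportional[of T1 T3 c x1 x2 x3 T2 c' y1 y2 y3]
      diagonal_in_metric_pos[OF V(1) g(1) x] diagonal_in_metric_pos[OF V(1) g(2) y] T12
      sol(1)[unfolded diagonal_solution_iff[OF T V(2,1) g(1) x]]
      sol(2)[unfolded diagonal_solution_iff[OF T V(2,1) g(2) y]] by auto
  then obtain k where k: "c' = c" "k > 0" "y1 = k * x1" "y2 = k * x2" "y3 = k * x3" by blast
  have "g' = (\<lambda>x y. k * g x y)"
    using diagonal_in_unique[OF bl(2) bilinear_scale[OF bl(1)] V(1) y, of k]
      diagonal_in_scale[OF x, of k] by (simp add: k)
  with k show ?thesis by auto
qed

lemma solution_exists_indefinite:
  assumes T: "bilinear T" and V: "e11_basis V" "diagonal_in V T T1 T2 T3"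
    and T12: "T1 + T2 > 0" "T3 < 0" "T1 * T2 < 0"
  shows "\<exists>g c. (g, c) \<in> solutions T"
proof -
  \<comment> \<open>The equations force \<open>x1 : x2 = \<bar>T1\<bar> : \<bar>T2\<bar>\<close>; \<open>r\<close> is the sign of \<open>T1\<close> and \<open>- r\<close> that of \<open>T2\<close>.
    Then \<open>c\<close> is solved for from the third equation and \<open>x3\<close> from the first.\<close>
  define r where "r = sgn T1"
  have r: "r * T1 > 0" "- r * T2 > 0" "r = 1 \<or> r = - 1"
    using T12 by (auto simp: r_def sgn_if mult_less_0_iff)
  define x1 x2 x3 c where d: "x1 = r * T1" "x2 = - r * T2" "x3 = (T1 + T2) * - T3 / (x1 + x2)"
    "c = 2 * (x1 + x2)\<^sup>2 / (x1 * x2 * - T3)"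
  have pos: "x1 > 0" "x2 > 0" using r by (simp_all add: d)
  have T': "T1 = r * x1" "T2 = - r * x2" using r by (auto simp: d)
  have pos3: "x3 > 0" "c > 0"
    unfolding d(3,4) using pos T12
    by (intro divide_pos_pos mult_pos_pos zero_less_power; simp)+
  have c3: "- 2 * (x1 + x2)\<^sup>2 = c * T3 * (x1 * x2)"
    using pos T12 by (simp add: d(4))
  have dx: "x3 * (x1 + x2) = (T1 + T2) * - T3" using pos by (simp add: d(3))
  have "(c * x3 * (x1 * x2)) * ((x1 + x2) * - T3) = - (c * T3 * (x1 * x2)) * (x3 * (x1 + x2))"
    by (simp add: algebra_simps)
  also have "\<dots> = (2 * (T1 + T2) * (x1 + x2)) * ((x1 + x2) * - T3)"
    unfolding dx c3[symmetric] by (simp add: power2_eq_square algebra_simps)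
  finally have "c * x3 * (x1 * x2) = 2 * (T1 + T2) * (x1 + x2)"
    using pos T12 by (subst (asm) mult_cancel_right) simp
  then have cx: "r * (c * x3 * (x1 * x2)) = r * (2 * (r * x1 - r * x2) * (x1 + x2))"
    by (simp add: T')
  have c1: "2 * (x1\<^sup>2 - x2\<^sup>2) = c * T1 * (x2 * x3)"
    using cx r(3) by (auto simp: T' power2_eq_square algebra_simps)
  have c2: "2 * (x2\<^sup>2 - x1\<^sup>2) = c * T2 * (x1 * x3)"
    using cx r(3) by (auto simp: T' power2_eq_square algebra_simps)
  obtain g where "left_invariant_metric g" "diagonal_in V g x1 x2 x3"
    using diagonal_metric_exists[OF V(1) pos pos3(1)] by blast
  then show ?thesis
    using diagonal_solution_iff[OF T V(2,1)] c1 c2 c3 pos3 by blast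
qed

lemma solution_exists_degenerate:
  assumes T: "bilinear T" and V: "e11_basis V" "diagonal_in V T 0 0 T3" and T3: "T3 < 0"
    and g: "left_invariant_metric g" "diagonal_in V g 1 1 t"
  shows "(g, - 8 / T3) \<in> solutions T"
  unfolding diagonal_solution_iff[OF T V(2,1) g] using T3 by (simp add: divide_neg_neg)

text \<open>
  The metrics \<open>diag(1, 1, t)\<close> all solve the equation with the same constant, and for different
  \<open>t\<close> they are not multiples of each other.
\<close>

lemma infinite_solutions_degenerate:
  assumes T: "bilinear T" and V: "e11_basis V" "diagonal_in V T 0 0 T3" and T3: "T3 < 0"
  shows "infinite (solutions T // scaling)"
proof -
  have "\<exists>g. t > 0 \<longrightarrow> left_invariant_metric g \<and> diagonal_in V g 1 1 t" for t
    using diagonal_metric_exists[OF V(1), of 1 1 t] by auto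
  then obtain G where G: "\<And>t. t > 0 \<Longrightarrow> left_invariant_metric (G t) \<and> diagonal_in V (G t) 1 1 t"
    by metis
  define F where "F t = scaling `` {(G t, - 8 / T3)}" for t
  have "inj_on F {0<..}"
  proof (rule inj_onI)
    fix s t :: real assume st: "s \<in> {0<..}" "t \<in> {0<..}" "F s = F t"
    then have "((G s, - 8 / T3), (G t, - 8 / T3)) \<in> scaling"
      using eq_equiv_class[OF st(3)[unfolded F_def] equiv_scaling] by simp
    then obtain a where "G t = (\<lambda>x y. a * G s x y)" by (auto simp: scaling_def fun_eq_iff)
    then have "diagonal_in V (G t) (a * 1) (a * 1) (a * s)"
      using diagonal_in_scale[of V "G s" 1 1 s a] G st by auto
    then show "s = t" using diagonal_in_coefficients[of V "G t" 1 1 t] G st by force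
  qed
  moreover have "F ` {0<..} \<subseteq> solutions T // scaling"
    using solution_exists_degenerate[OF T V T3] G by (auto simp: F_def intro!: quotientI)
  ultimately show ?thesis
    using infinite_Ioi[of "0::real"] finite_imageD finite_subset by metis
qed

text \<open>
  The metric is diagonal in a basis \<open>W\<close> that may differ from \<open>V\<close>. But \<open>T\<close> only sees the third
  coordinate with respect to \<open>V\<close>, which is \<open>0\<close> for \<open>W 1\<close> and \<open>\<plusminus> 1\<close> for \<open>W 3\<close>. So the
  first and third diagonal entries of \<open>T\<close> are the same in \<open>W\<close>, and the equations for them
  determine \<open>c\<close>.
\<close>

lemma solution_constant_degenerate:
  assumes T: "bilinear T" and V: "e11_basis V" "diagonal_in V T 0 0 T3"
    and gc: "(g, c) \<in> solutions T"
  shows "c * T3 = - 8"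
proof -
  obtain W S1 S2 S3 y1 y2 y3 where W: "e11_basis W" "diagonal_in W T S1 S2 S3"
    "diagonal_in W g y1 y2 y3" using solution_diagonalisable[OF T gc] by metis
  have g: "left_invariant_metric g" using gc by (auto simp: solutions_def)
  note pos = diagonal_in_metric_pos[OF W(1) g W(3)]
  obtain a b p q s where s: "s = 1 \<or> s = - 1" and
    w: "W 1 = a *\<^sub>R V 1 + b *\<^sub>R V 2" "W 3 = p *\<^sub>R V 1 + q *\<^sub>R V 2 + s *\<^sub>R V 3"
    using e11_basis_change[OF V(1) W(1)] by metis
  note lins = bilinear_ladd[OF T] bilinear_radd[OF T] bilinear_lmul[OF T] bilinear_rmul[OF T]
  have VT: "T (V i) (V j) = (if i = 3 \<and> j = 3 then T3 else 0)" for i j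
    using V(2) exhaust_3[of i] by (auto simp: diagonal_in_def vector_3)
  have "T (W 1) (W 1) = S1" "T (W 3) (W 3) = S3"
    using W(2) by (simp_all add: diagonal_in_def vector_3)
  then have "S1 = 0" "S3 = T3" using s by (auto simp: w lins VT)
  then have e: "2 * (y1\<^sup>2 - y2\<^sup>2) = 0" "- 2 * (y1 + y2)\<^sup>2 = c * T3 * (y1 * y2)"
    using gc unfolding diagonal_solution_iff[OF T W(2,1) g W(3)] by simp_all
  then have "y1 = y2" using pos by (simp add: power2_eq_iff_nonneg)
  then have "(c * T3 + 8) * (y1 * y1) = 0" using e(2) by (simp add: power2_eq_square algebra_simps)
  then show ?thesis using pos by simp
qed

lemma solvable_imp_sign_conditions:
  assumes T: "bilinear T" and gc: "(g, c) \<in> solutions T"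
  shows "\<exists>V T1 T2 T3. e11_basis V \<and> diagonal_in V T T1 T2 T3 \<and>
    ((T1 = 0 \<and> T2 = 0 \<and> T3 < 0) \<or> (T1 + T2 > 0 \<and> T3 < 0 \<and> T1 * T2 < 0))"
proof -
  obtain V T1 T2 T3 x1 x2 x3 where V: "e11_basis V" "diagonal_in V T T1 T2 T3"
    "diagonal_in V g x1 x2 x3" using solution_diagonalisable[OF T gc] by metis
  have g: "left_invariant_metric g" using gc by (auto simp: solutions_def)
  note pos = diagonal_in_metric_pos[OF V(1) g V(3)]
  have c: "c > 0" and e: "2 * (x1\<^sup>2 - x2\<^sup>2) = c * T1 * (x2 * x3)"
    "2 * (x2\<^sup>2 - x1\<^sup>2) = c * T2 * (x1 * x3)" "- 2 * (x1 + x2)\<^sup>2 = c * T3 * (x1 * x2)"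
    using gc unfolding diagonal_solution_iff[OF T V(2,1) g V(3)] by simp_all
  \<comment> \<open>The positive factor in \<open>T1 = m (x1 - x2) x1\<close> and \<open>T2 = - m (x1 - x2) x2\<close>.\<close>
  define m where "m = 2 * (x1 + x2) / (c * x1 * x2 * x3)"
  have m: "m > 0" using pos c by (simp add: m_def)
  have T1: "T1 = m * (x1 - x2) * x1"
    using e(1) pos c by (simp add: m_def field_simps power2_eq_square)
  have T2: "T2 = - m * (x1 - x2) * x2"
    using e(2) pos c by (simp add: m_def field_simps power2_eq_square)
  have "T3 = - (2 * (x1 + x2)\<^sup>2 / (c * (x1 * x2)))"
    using e(3) pos c by (simp add: field_simps)
  then have T3: "T3 < 0" using pos c by simp
  show ?thesis
  proof (cases "x1 = x2")
    case True
    then show ?thesis using V T1 T2 T3 by auto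
  next
    case False
    have "T1 + T2 = m * (x1 - x2)\<^sup>2" by (simp add: T1 T2 power2_eq_square algebra_simps)
    then have "T1 + T2 > 0" using m False by simp
    moreover have "T1 * T2 = - ((m * (x1 - x2))\<^sup>2 * (x1 * x2))"
      by (simp add: T1 T2 power2_eq_square algebra_simps)
    then have "T1 * T2 < 0" using m False pos by simp
    ultimately show ?thesis using V T3 by blast
  qed
qed

section \<open>Solvability and uniqueness\<close>

theorem theorem6p2:
  fixes T :: "real^3 \<Rightarrow> real^3 \<Rightarrow> real"
  assumes "bilinear T"
  shows
    "((\<exists>g c. (g, c) \<in> solutions T) \<longleftrightarrow>
       (\<exists>V T1 T2 T3. e11_basis V \<and> diagonal_in V T T1 T2 T3 \<and>
          ((T1 = 0 \<and> T2 = 0 \<and> T3 < 0) \<or>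
           (T1 + T2 > 0 \<and> T3 < 0 \<and> T1 * T2 < 0)))) \<and>
     (\<forall>V T1 T2 T3. e11_basis V \<and> diagonal_in V T T1 T2 T3 \<and>
          T1 = 0 \<and> T2 = 0 \<and> T3 < 0 \<longrightarrow>
        infinite (solutions T // scaling) \<and>
        (\<forall>g c g' c'. (g, c) \<in> solutions T \<and> (g', c') \<in> solutions T \<longrightarrow> c' = c)) \<and>
     (\<forall>V T1 T2 T3. e11_basis V \<and> diagonal_in V T T1 T2 T3 \<and>
          T1 + T2 > 0 \<and> T3 < 0 \<and> T1 * T2 < 0 \<longrightarrow>
        (\<exists>g c. (g, c) \<in> solutions T \<and>
           (\<forall>g' c'. (g', c') \<in> solutions T \<longrightarrow>
              c' = c \<and> (\<exists>a>0. \<forall>x y. g' x y = a * g x y))))"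
proof -
  note T = assms
  have deg: "infinite (solutions T // scaling)"
    if "e11_basis V" "diagonal_in V T 0 0 T3" "T3 < 0" for V T3
    using infinite_solutions_degenerate[OF T that] .
  have const: "c' = c"
    if "e11_basis V" "diagonal_in V T 0 0 T3" "T3 < 0"
      "(g, c) \<in> solutions T" "(g', c') \<in> solutions T" for V T3 g c g' c'
  proof -
    have "c * T3 = c' * T3"
      using solution_constant_degenerate[OF T that(1,2)] that(4,5) by metis
    then show ?thesis using that(3) by simp
  qed
  have indef: "\<exists>g c. (g, c) \<in> solutions T \<and> (\<forall>g' c'. (g', c') \<in> solutions T \<longrightarrow>
      c' = c \<and> (\<exists>a>0. \<forall>x y. g' x y = a * g x y))"
    if V: "e11_basis V" "diagonal_in V T T1 T2 T3" and T3: "T1 + T2 > 0" "T3 < 0" "T1 * T2 < 0"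
    for V T1 T2 T3
  proof -
    obtain g c where gc: "(g, c) \<in> solutions T"
      using solution_exists_indefinite[OF T V T3] by blast
    have "T1 + T2 \<noteq> 0" "T1 * T2 \<noteq> 0" "T3 \<noteq> 0" using T3 by auto
    then show ?thesis using solutions_unique_up_to_scaling[OF T V _ _ _ gc] gc by blast
  qed
  have "\<exists>g c. (g, c) \<in> solutions T"
    if "e11_basis V" "diagonal_in V T 0 0 T3" "T3 < 0" for V T3
  proof -
    have "solutions T \<noteq> {}" using deg[OF that] by auto
    then show ?thesis by auto
  qed
  then have "(\<exists>g c. (g, c) \<in> solutions T) \<longleftrightarrow> (\<exists>V T1 T2 T3. e11_basis V \<and> diagonal_in V T T1 T2 T3 \<and>
      ((T1 = 0 \<and> T2 = 0 \<and> T3 < 0) \<or> (T1 + T2 > 0 \<and> T3 < 0 \<and> T1 * T2 < 0)))"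
    using solvable_imp_sign_conditions[OF T] indef by blast
  moreover note deg const indef
  ultimately show ?thesis by blast
qed

end
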